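(* Let $S$ be a numerical semigroup with multiplicity $m$, $E$ an ideal of $S$ with $0\notin E$, and $b\in S$ an odd integer. Let $\operatorname{Ap}_m(S)=\{\delta_1,\dots,\delta_m\}$ and $\operatorname{Ap}_m(E)=\{\beta_1,\dots,\beta_m\}$. Then $S\Join^b E$ is homogeneous if and only if $S$ is homogeneous, $E$ is homogeneous and $\delta_i\notin2E+b$ for all $i$.
   Context: A numerical semigroup is a submonoid $S$ of $(\mathbb N,+)$ with $\mathbb N\setminus S$ finite; its multiplicity $m$ is its smallest nonzero element. An ideal of $S$ is a non-empty set $E\subseteq S$ with $E+S\subseteq E$; its minimal generators are the unique $e_1,\dots,e_r$ with $E=\bigcup_i(e_i+S)$ and $e_i\notin\bigcup_{j\ne i}(e_j+S)$. The numerical duplication is the numerical semigroup $S\Join^b E=\{2s\mid s\in S\}\cup\{2e+b\mid e\in E\}$. $\operatorname{Ap}_m(S)=\{s\in S\mid s-m\notin S\}$ and $\operatorname{Ap}_m(E)=\{e\in E\mid e-m\notin E\}$. $2E=E+E$ is the sumset, and $2E+b=\{x+b\mid x\in2E\}$. For a numerical semigroup $U$ with minimal generators $g_1,\dots,g_p$ and $z\in\mathbb Z$, $\mathcal L(z)=\{\sum_ic_i\mid c_i\in\mathbb N,\ z=\sum_ic_ig_i\}$ is the set of lengths of representations of $z$ (empty if $z\notin U$). An integer $z$ is homogeneous for $U$ if either $z\notin U$ or $\mathcal L(z)$ is a singleton. $U$ is homogeneous if every element of its Apéry set with respect to its multiplicity is homogeneous for $U$. The ideal $E$ of $S$ is homogeneous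 if $\beta_i-e_j$ is homogeneous for $S$ for all $i,j$, and, for each $i$, all the non-empty sets among $\mathcal L(\beta_i-e_1),\dots,\mathcal L(\beta_i-e_r)$ (lengths with respect to $S$) are equal. *)

theory Defs
  imports Complex_Main "HOL-Library.Set_Algebras"
begin

definition numerical_semigroup :: "nat set \<Rightarrow> bool" where
  "numerical_semigroup S \<longleftrightarrow>
     0 \<in> S \<and> (\<forall>x\<in>S. \<forall>y\<in>S. x + y \<in> S) \<and> finite (UNIV - S)"

definition multiplicity :: "nat set \<Rightarrow> nat" where
  "multiplicity S = (LEAST n. n \<in> S \<and> n \<noteq> 0)"

definition sg_ideal :: "nat set \<Rightarrow> nat set \<Rightarrow> bool" where
  "sg_ideal S E \<longleftrightarrow> E \<noteq> {} \<and> E \<subseteq> S \<and> E + S \<subseteq> E"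

definition duplication :: "nat set \<Rightarrow> nat \<Rightarrow> nat set \<Rightarrow> nat set" where
  "duplication S b E = {2 * s | s. s \<in> S} \<union> {2 * e + b | e. e \<in> E}"

text \<open>The subtraction is that of the integers: an element of \<open>X\<close> smaller than \<open>m\<close>
  always belongs to the Apery set.\<close>

definition apery :: "nat \<Rightarrow> nat set \<Rightarrow> nat set" where
  "apery m X = {x \<in> X. int x - int m \<notin> int ` X}"

definition generated_by :: "nat set \<Rightarrow> nat set" where
  "generated_by A = {\<Sum>g\<in>A. c g * g | c :: nat \<Rightarrow> nat. True}"

text \<open>The sum in the definition above is only meaningful for finite \<open>A\<close>, whence the explicit
  finiteness requirement.\<close>

definition is_min_gens :: "nat set \<Rightarrow> nat set \<Rightarrow> bool" where
  "is_min_gens U A \<longleftrightarrow>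
     finite A \<and> generated_by A = U \<and> (\<forall>B. B \<subset> A \<longrightarrow> generated_by B \<noteq> U)"

definition min_gens :: "nat set \<Rightarrow> nat set" where
  "min_gens U = (THE A. is_min_gens U A)"

definition is_ideal_min_gens :: "nat set \<Rightarrow> nat set \<Rightarrow> nat set \<Rightarrow> bool" where
  "is_ideal_min_gens S E G \<longleftrightarrow>
     finite G \<and> E = (\<Union>e\<in>G. e +o S) \<and> (\<forall>e\<in>G. e \<notin> (\<Union>f\<in>G - {e}. f +o S))"

definition ideal_min_gens :: "nat set \<Rightarrow> nat set \<Rightarrow> nat set" where
  "ideal_min_gens S E = (THE G. is_ideal_min_gens S E G)"

definition lengths :: "nat set \<Rightarrow> int \<Rightarrow> nat set" where
  "lengths U z = {\<Sum>g\<in>min_gens U. c g | c :: nat \<Rightarrow> nat. z = int (\<Sum>g\<in>min_gens U. c g * g)}"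

definition homogeneous_elem :: "nat set \<Rightarrow> int \<Rightarrow> bool" where
  "homogeneous_elem U z \<longleftrightarrow> z \<notin> int ` U \<or> is_singleton (lengths U z)"

definition homogeneous_sg :: "nat set \<Rightarrow> bool" where
  "homogeneous_sg U \<longleftrightarrow> (\<forall>x\<in>apery (multiplicity U) U. homogeneous_elem U (int x))"

definition homogeneous_ideal :: "nat set \<Rightarrow> nat set \<Rightarrow> bool" where
  "homogeneous_ideal S E \<longleftrightarrow>
     (\<forall>\<beta>\<in>apery (multiplicity S) E.
        (\<forall>e\<in>ideal_min_gens S E. homogeneous_elem S (int \<beta> - int e)) \<and>
        (\<forall>e\<in>ideal_min_gens S E. \<forall>f\<in>ideal_min_gens S E.
           lengths S (int \<beta> - int e) \<noteq> {} \<longrightarrow> lengths S (int \<beta> - int f) \<noteq> {} \<longrightarrow>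
           lengths S (int \<beta> - int e) = lengths S (int \<beta> - int f)))"

text \<open>Both systems of minimal generators exist and are unique, so the definite descriptions
  above are meaningful.\<close>

lemma numerical_semigroup_pos:
  assumes "numerical_semigroup S"
  obtains m where "m \<in> S" "m > 0"
proof -
  have "infinite S"
    using assms unfolding numerical_semigroup_def
    by (metis finite_Diff2 infinite_UNIV_nat)
  then have "\<not> S \<subseteq> {0}"
    using finite_subset by blast
  then show ?thesis using that by auto
qed

lemma numerical_semigroup_mult:
  assumes "numerical_semigroup S" "x \<in> S"
  shows "k * x \<in> S"
  using assms by (induction k) (auto simp: numerical_semigroup_def)

lemma finite_irreducible:
  assumes "numerical_semigroup S"
    and irr: "\<And>x s. x \<in> A \<Longrightarrow> s \<in> S \<Longrightarrow> s \<noteq> 0 \<Longrightarrow> x + s \<notin> A"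
  shows "finite A"
proof -
  obtain m where m: "m \<in> S" "m > 0"
    using numerical_semigroup_pos assms(1) by blast
  have *: "\<not> x < y" if xy: "x \<in> A" "y \<in> A" "x mod m = y mod m" for x y
  proof
    assume "x < y"
    then have "m dvd y - x"
      using mod_eq_dvd_iff_nat[of x y m] xy(3) by simp
    then obtain k where "y - x = m * k"
      by blast
    with \<open>x < y\<close> have "y = x + m * k"
      by simp
    moreover from this \<open>x < y\<close> have "k * m \<noteq> 0" by auto
    ultimately show False
      using irr[OF xy(1) numerical_semigroup_mult[OF assms(1) m(1)]] xy(2)
      by (simp add: mult.commute)
  qed
  have "inj_on (\<lambda>x. x mod m) A"
  proof (rule inj_onI)
    fix x y assume "x \<in> A" "y \<in> A" "x mod m = y mod m"
    then show "x = y" using *[of x y] *[of y x] by simp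
  qed
  moreover have "(\<lambda>x. x mod m) ` A \<subseteq> {..<m}"
    using m by auto
  ultimately show ?thesis
    by (meson finite_lessThan inj_on_finite)
qed

lemma sum_in_numerical_semigroup:
  assumes "numerical_semigroup S" "finite A" "A \<subseteq> S"
  shows "(\<Sum>g\<in>A. c g * g) \<in> S"
  using assms(2,3)
proof (induction A rule: finite_induct)
  case empty
  then show ?case using assms(1) by (simp add: numerical_semigroup_def)
next
  case (insert x F)
  then show ?case
    using numerical_semigroup_mult[OF assms(1), of x "c x"] assms(1)
    by (simp add: numerical_semigroup_def)
qed

lemma generated_by_add:
  assumes "x \<in> generated_by A" "y \<in> generated_by A"
  shows "x + y \<in> generated_by A"
proof -
  obtain c d where "x = (\<Sum>g\<in>A. c g * g)" "y = (\<Sum>g\<in>A. d g * g)"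
    using assms by (auto simp: generated_by_def)
  then have "x + y = (\<Sum>g\<in>A. (c g + d g) * g)"
    by (simp add: sum.distrib algebra_simps)
  then show ?thesis unfolding generated_by_def
    by (intro CollectI exI[of _ "\<lambda>g. c g + d g"]) simp
qed

lemma generated_by_base:
  assumes "finite A" "a \<in> A"
  shows "a \<in> generated_by A"
proof -
  have "(\<Sum>g\<in>A. (if g = a then 1 else 0) * g) = (\<Sum>g\<in>A. if g = a then g else 0)"
    by (intro sum.cong) auto
  also have "\<dots> = a" using assms by (simp add: sum.delta)
  finally show ?thesis unfolding generated_by_def
    by (intro CollectI exI[of _ "\<lambda>g. if g = a then 1 else 0"]) simp
qed

lemma is_min_gens_iff:
  assumes U: "numerical_semigroup U"
  shows "is_min_gens U A \<longleftrightarrow>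
    A = {x \<in> U. x \<noteq> 0 \<and> (\<forall>y\<in>U. \<forall>z\<in>U. x = y + z \<longrightarrow> y = 0 \<or> z = 0)}"
    (is "_ \<longleftrightarrow> A = ?I")
proof -
  have fin: "finite ?I"
    by (rule finite_irreducible[OF U]) auto
  have gen: "generated_by ?I = U"
  proof (intro equalityI subsetI)
    fix x assume "x \<in> generated_by ?I"
    then show "x \<in> U"
      using sum_in_numerical_semigroup[OF U fin] by (auto simp: generated_by_def)
  next
    fix x assume "x \<in> U"
    then show "x \<in> generated_by ?I"
    proof (induction x rule: less_induct)
      case (less x)
      consider "x = 0" | "x \<in> ?I" | y z where "y \<in> U" "z \<in> U" "x = y + z" "y \<noteq> 0" "z \<noteq> 0"
        using less.prems by blast
      then show ?case
      proof cases
        case 1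
        then show ?thesis unfolding generated_by_def
          by (intro CollectI exI[of _ "\<lambda>g. 0"]) simp
      next
        case 2
        then show ?thesis using generated_by_base[OF fin] by blast
      next
        case 3
        then show ?thesis using less.IH[of y] less.IH[of z] generated_by_add by simp
      qed
    qed
  qed
  have sub: "?I \<subseteq> B" if B: "finite B" "generated_by B = U" for B
  proof
    fix x assume x: "x \<in> ?I"
    then obtain c where c: "x = (\<Sum>g\<in>B. c g * g)"
      using B(2) by (auto simp: generated_by_def)
    have "\<exists>a\<in>B. c a * a \<noteq> 0"
    proof (rule ccontr)
      assume "\<not> ?thesis"
      then have "x = 0" unfolding c by (intro sum.neutral) blast
      with x show False by blast
    qed
    then obtain a where a: "a \<in> B" "c a * a \<noteq> 0" by blast
    then obtain k where k: "c a = Suc k"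
      by (cases "c a") auto
    have BU: "B \<subseteq> U" using generated_by_base[OF B(1)] B(2) by blast
    define t where "t = k * a + (\<Sum>g\<in>B - {a}. c g * g)"
    have xt: "x = a + t"
      using c k sum.remove[OF B(1) a(1), of "\<lambda>g. c g * g"] by (simp add: t_def)
    have "t \<in> U"
      using numerical_semigroup_mult[OF U, of a k] U a(1) BU
        sum_in_numerical_semigroup[OF U, of "B - {a}" c] B(1)
      by (auto simp: numerical_semigroup_def t_def)
    moreover have "a \<in> U" "a \<noteq> 0" using a BU by auto
    ultimately have "t = 0" using x xt by blast
    then show "x \<in> B"
      using xt a(1) by simp
  qed
  show ?thesis
  proof
    assume "is_min_gens U A"
    then have "finite A" "generated_by A = U"
      and min: "\<And>B. B \<subset> A \<Longrightarrow> generated_by B \<noteq> U"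
      by (simp_all add: is_min_gens_def)
    then have "?I \<subseteq> A" by (intro sub)
    moreover have "\<not> ?I \<subset> A" using min[of ?I] gen by fast
    ultimately show "A = ?I" by fast
  next
    assume A: "A = ?I"
    show "is_min_gens U A"
      unfolding is_min_gens_def
    proof (intro conjI allI impI)
      show "finite A" "generated_by A = U" using A fin gen by simp_all
      fix B assume "B \<subset> A"
      then have "finite B" "\<not> ?I \<subseteq> B"
        using A \<open>finite A\<close> finite_subset[of B A] by simp_all
      then show "generated_by B \<noteq> U"
        using sub[of B] by (intro notI) (rule notE)
    qed
  qed
qed

lemma min_gens_exists_unique:
  assumes "numerical_semigroup U"
  shows "\<exists>!A. is_min_gens U A"
  using is_min_gens_iff[OF assms] by simp

lemma is_ideal_min_gens_iff:
  assumes S: "numerical_semigroup S" and E: "sg_ideal S E"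
  shows "is_ideal_min_gens S E G \<longleftrightarrow> G = {x \<in> E. \<forall>y\<in>E. \<forall>s\<in>S. x = y + s \<longrightarrow> s = 0}"
    (is "_ \<longleftrightarrow> G = ?I")
proof -
  have ES: "x + s \<in> E" if "x \<in> E" "s \<in> S" for x s
    using E that by (auto simp: sg_ideal_def)
  have S0: "0 \<in> S" and Sadd: "\<And>x y. x \<in> S \<Longrightarrow> y \<in> S \<Longrightarrow> x + y \<in> S"
    using S by (auto simp: numerical_semigroup_def)
  have fin: "finite ?I"
    by (rule finite_irreducible[OF S]) auto
  show ?thesis
  proof
    assume G: "is_ideal_min_gens S E G"
    then have EG: "\<And>x. x \<in> E \<longleftrightarrow> (\<exists>f\<in>G. \<exists>s\<in>S. x = f + s)"
      by (auto simp: is_ideal_min_gens_def elt_set_plus_def)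
    have min: "\<And>e f s. e \<in> G \<Longrightarrow> f \<in> G \<Longrightarrow> s \<in> S \<Longrightarrow> e = f + s \<Longrightarrow> f = e"
    proof (rule ccontr)
      fix e f s assume *: "e \<in> G" "f \<in> G" "s \<in> S" "e = f + s" "f \<noteq> e"
      then have "e \<in> f +o S" by (simp add: elt_set_plus_def)
      then have "e \<in> (\<Union>f\<in>G - {e}. f +o S)" using * by blast
      then show False using G *(1) unfolding is_ideal_min_gens_def by fast
    qed
    show "G = ?I"
    proof (intro equalityI subsetI)
      fix x assume x: "x \<in> G"
      have "s = 0" if y: "y \<in> E" and s: "s \<in> S" "x = y + s" for y s
      proof -
        obtain f t where "f \<in> G" "t \<in> S" "y = f + t" using EG[of y] y by blast
        with min[OF x, of f "t + s"] s Sadd show ?thesis by (simp add: add.assoc)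
      qed
      moreover have "x \<in> E" using EG[of x] x S0 add.right_neutral[of x, symmetric] by blast
      ultimately show "x \<in> ?I" by blast
    next
      fix x assume x: "x \<in> ?I"
      then obtain f s where fs: "f \<in> G" "s \<in> S" "x = f + s" using EG[of x] by blast
      moreover have "f \<in> E" using EG[of f] fs(1) S0 add.right_neutral[of f, symmetric] by blast
      ultimately show "x \<in> G" using x by auto
    qed
  next
    assume G: "G = ?I"
    have "\<exists>f\<in>?I. \<exists>s\<in>S. x = f + s" if "x \<in> E" for x
      using that
    proof (induction x rule: less_induct)
      case (less x)
      show ?case
      proof (cases "x \<in> ?I")
        case True
        then show ?thesis using S0 by (intro bexI[of _ x] bexI[of _ 0]) auto
      next
        case False
        then obtain y s where ys: "y \<in> E" "s \<in> S" "x = y + s" "s \<noteq> 0"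
          using less.prems by blast
        then have "y < x" by simp
        from less.IH[OF this ys(1)] obtain f t where f: "f \<in> ?I" and t: "t \<in> S" "y = f + t"
          by blast
        have "x = f + (t + s)" using t(2) ys(3) by (simp add: add.assoc)
        moreover have "t + s \<in> S" using Sadd[OF t(1) ys(2)] .
        ultimately show ?thesis using f by blast
      qed
    qed
    then have "E \<subseteq> (\<Union>e\<in>?I. e +o S)"
      unfolding elt_set_plus_def by blast
    moreover have "(\<Union>e\<in>?I. e +o S) \<subseteq> E"
      unfolding elt_set_plus_def using ES by blast
    moreover have "\<forall>e\<in>?I. e \<notin> (\<Union>f\<in>?I - {e}. f +o S)"
    proof (intro ballI notI)
      fix e assume e: "e \<in> ?I" "e \<in> (\<Union>f\<in>?I - {e}. f +o S)"
      then obtain f s where f: "f \<in> E" "f \<noteq> e" and s: "s \<in> S" "e = f + s"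
        unfolding elt_set_plus_def by blast
      then have "s = 0" using e(1) by blast
      with f(2) s(2) show False by simp
    qed
    ultimately show "is_ideal_min_gens S E G"
      unfolding is_ideal_min_gens_def G using fin by (intro conjI equalityI)
  qed
qed

lemma ideal_min_gens_exists_unique:
  assumes "numerical_semigroup S" "sg_ideal S E"
  shows "\<exists>!G. is_ideal_min_gens S E G"
  using is_ideal_min_gens_iff[OF assms] by simp

end

theory Submission imports Defs begin

text \<open>The minimal generators of \<open>S \<Join>\<^sup>b E\<close> are the \<open>2 * g\<close> and the \<open>2 * e + b\<close>, for minimal
  generators \<open>g\<close> of \<open>S\<close> and \<open>e\<close> of \<open>E\<close>, and its Apery set consists of the \<open>2 * \<delta>\<^sub>i\<close> and the
  \<open>2 * \<beta>\<^sub>i + b\<close>.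
  A representation of \<open>2 * \<delta>\<^sub>i\<close> using odd generators puts \<open>\<delta>\<^sub>i\<close> in \<open>2E + b\<close>, and expanding two of
  these odd generators and \<open>b\<close> in \<open>S\<close> gives a strictly longer representation.
  A representation of \<open>2 * \<beta>\<^sub>i + b\<close> with exactly one odd generator \<open>2 * e + b\<close> is a representation
  of \<open>\<beta>\<^sub>i - e\<close> in \<open>S\<close>, lengthened by one; if there are three or more odd generators, then the
  Apery element \<open>\<beta>\<^sub>i - e\<close> of \<open>S\<close> lies in \<open>2E + b\<close>.\<close>

section \<open>Representations of a given length\<close>

text \<open>Lengths are built into the predicate, and summands are added one at a time.
  Concatenating representations, or splitting off a single generator, is then direct, unlike with
  coefficient functions.\<close>

inductive nfold_sum :: "nat set \<Rightarrow> nat \<Rightarrow> nat \<Rightarrow> bool" for A where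
  nfold_sum_0: "nfold_sum A 0 0"
| nfold_sum_Suc: "g \<in> A \<Longrightarrow> nfold_sum A k x \<Longrightarrow> nfold_sum A (Suc k) (g + x)"

lemma nfold_sum_0_iff [simp]: "nfold_sum A 0 x \<longleftrightarrow> x = 0"
  by (auto intro: nfold_sum_0 elim: nfold_sum.cases)

lemma nfold_sum_Suc_iff:
  "nfold_sum A (Suc k) x \<longleftrightarrow> (\<exists>g\<in>A. \<exists>y. x = g + y \<and> nfold_sum A k y)"
  using nfold_sum.simps[of A "Suc k" x] by auto

lemma nfold_sum_add:
  assumes "nfold_sum A k x" "nfold_sum A l y"
  shows "nfold_sum A (k + l) (x + y)"
  using assms by induction (auto simp: add.assoc intro: nfold_sum_Suc)

lemma nfold_sum_mult: "g \<in> A \<Longrightarrow> nfold_sum A n (n * g)"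
  by (induction n) (auto intro: nfold_sum_Suc)

text \<open>The coefficient \<open>c g\<close> counts how often \<open>g\<close> occurs as a
  summand. This links the predicate to the coefficient functions in \<open>generated_by\<close> and
  \<open>lengths\<close>.\<close>

lemma nfold_sum_iff:
  assumes "finite A"
  shows "nfold_sum A k x \<longleftrightarrow> (\<exists>c. k = (\<Sum>g\<in>A. c g) \<and> x = (\<Sum>g\<in>A. c g * g))"
proof
  assume "nfold_sum A k x"
  then show "\<exists>c. k = (\<Sum>g\<in>A. c g) \<and> x = (\<Sum>g\<in>A. c g * g)"
  proof induction
    case nfold_sum_0
    show ?case by (intro exI[of _ "\<lambda>_. 0"]) simp
  next
    case (nfold_sum_Suc h k x)
    then obtain c where c: "k = (\<Sum>g\<in>A. c g)" "x = (\<Sum>g\<in>A. c g * g)" by blast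
    have "(\<Sum>g\<in>A. (c(h := Suc (c h))) g) = Suc k"
      "(\<Sum>g\<in>A. (c(h := Suc (c h))) g * g) = h + x"
      using nfold_sum_Suc.hyps(1) assms by (simp_all add: c sum.remove[of A h])
    then show ?case by metis
  qed
next
  assume "\<exists>c. k = (\<Sum>g\<in>A. c g) \<and> x = (\<Sum>g\<in>A. c g * g)"
  then obtain c where c: "k = (\<Sum>g\<in>A. c g)" "x = (\<Sum>g\<in>A. c g * g)" by blast
  \<comment> \<open>Only the range of the sums grows in the induction; the set \<open>A\<close> of
    admissible summands stays fixed, so that \<open>nfold_sum_add\<close> applies.\<close>
  have "nfold_sum A (\<Sum>g\<in>B. c g) (\<Sum>g\<in>B. c g * g)" if "B \<subseteq> A" for B
    using finite_subset[OF that assms] that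
    by (induction B rule: finite_induct) (simp_all add: nfold_sum_add nfold_sum_mult)
  then show "nfold_sum A k x" by (simp add: c)
qed

section \<open>Lengths and homogeneity in terms of representations\<close>

lemma numerical_semigroup_0: "numerical_semigroup S \<Longrightarrow> 0 \<in> S"
  by (simp add: numerical_semigroup_def)

lemma numerical_semigroup_add:
  "numerical_semigroup S \<Longrightarrow> x \<in> S \<Longrightarrow> y \<in> S \<Longrightarrow> x + y \<in> S"
  by (simp add: numerical_semigroup_def)

lemma is_min_gens_min_gens: "numerical_semigroup U \<Longrightarrow> is_min_gens U (min_gens U)"
  unfolding min_gens_def by (rule theI') (rule min_gens_exists_unique)

lemma min_gens_eq:
  assumes "numerical_semigroup U"
  shows "min_gens U = {x \<in> U. x \<noteq> 0 \<and> (\<forall>y\<in>U. \<forall>z\<in>U. x = y + z \<longrightarrow> y = 0 \<or> z = 0)}"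
  using is_min_gens_iff[OF assms] is_min_gens_min_gens[OF assms] by simp

lemma min_gens_irreducible:
  assumes "numerical_semigroup U" "x \<in> min_gens U" "y \<in> U" "z \<in> U" "x = y + z"
  shows "y = 0 \<or> z = 0"
  using assms(2-) unfolding min_gens_eq[OF assms(1)] by simp

lemma mem_numerical_semigroup_iff:
  assumes "numerical_semigroup U"
  shows "x \<in> U \<longleftrightarrow> (\<exists>k. nfold_sum (min_gens U) k x)"
  using is_min_gens_min_gens[OF assms]
  by (auto simp: is_min_gens_def generated_by_def nfold_sum_iff)

lemma lengths_eq:
  assumes "numerical_semigroup U"
  shows "lengths U (int x) = {k. nfold_sum (min_gens U) k x}"
  using is_min_gens_min_gens[OF assms]
  by (auto simp: is_min_gens_def lengths_def nfold_sum_iff simp del: of_nat_sum)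

lemma lengths_nonempty:
  assumes "k \<in> lengths U z"
  obtains x where "z = int x"
  using assms that unfolding lengths_def by blast

text \<open>An integer outside \<open>U\<close> has no lengths and one inside has at least one, so
  both alternatives of the definition amount to having at most one length.\<close>

lemma homogeneous_elem_iff:
  assumes "numerical_semigroup U"
  shows "homogeneous_elem U z \<longleftrightarrow> (\<forall>k\<in>lengths U z. \<forall>l\<in>lengths U z. k = l)"
proof (cases "z \<in> int ` U")
  case True
  then obtain k where "k \<in> lengths U z"
    using mem_numerical_semigroup_iff[OF assms] lengths_eq[OF assms] by auto
  then show ?thesis
    using True by (auto simp: homogeneous_elem_def is_singleton_def)
next
  case False
  then have "lengths U z = {}"
    using mem_numerical_semigroup_iff[OF assms] lengths_eq[OF assms]
    by (metis all_not_in_conv image_eqI lengths_nonempty mem_Collect_eq)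
  with False show ?thesis by (simp add: homogeneous_elem_def)
qed

lemma homogeneous_sg_iff:
  assumes "numerical_semigroup U"
  shows "homogeneous_sg U \<longleftrightarrow> (\<forall>x\<in>apery (multiplicity U) U. \<forall>k l.
    nfold_sum (min_gens U) k x \<longrightarrow> nfold_sum (min_gens U) l x \<longrightarrow> k = l)"
  unfolding homogeneous_sg_def homogeneous_elem_iff[OF assms] lengths_eq[OF assms] by blast

text \<open>Both conditions of the definition merge into one: the case \<open>e = f\<close> is
  homogeneity of the difference, and for different generators two non-empty sets without distinct
  lengths between them are the same singleton.\<close>

lemma homogeneous_ideal_iff:
  assumes S: "numerical_semigroup S"
  shows "homogeneous_ideal S E \<longleftrightarrow>
    (\<forall>\<beta>\<in>apery (multiplicity S) E. \<forall>e\<in>ideal_min_gens S E. \<forall>f\<in>ideal_min_gens S E. \<forall>x y k l.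
      \<beta> = e + x \<longrightarrow> \<beta> = f + y \<longrightarrow> nfold_sum (min_gens S) k x \<longrightarrow> nfold_sum (min_gens S) l y
      \<longrightarrow> k = l)" (is "_ \<longleftrightarrow> ?R")
proof
  assume E: "homogeneous_ideal S E"
  show ?R
  proof (intro ballI allI impI)
    fix \<beta> e f x y k l
    assume *: "\<beta> \<in> apery (multiplicity S) E" "e \<in> ideal_min_gens S E" "f \<in> ideal_min_gens S E"
      "\<beta> = e + x" "\<beta> = f + y" "nfold_sum (min_gens S) k x" "nfold_sum (min_gens S) l y"
    then have "int \<beta> - int e = int x" "int \<beta> - int f = int y" by simp_all
    then have k: "k \<in> lengths S (int \<beta> - int e)" and l: "l \<in> lengths S (int \<beta> - int f)"
      using *(6,7) by (simp_all add: lengths_eq[OF S])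
    \<comment> \<open>Both length sets are non-empty, hence equal, and homogeneity of \<beta> - e
      then compares \<open>k\<close> with \<open>l\<close> inside a single set.\<close>
    then have "l \<in> lengths S (int \<beta> - int e)"
      using E *(1-3) unfolding homogeneous_ideal_def by blast
    then show "k = l"
      using E *(1,2) k unfolding homogeneous_ideal_def homogeneous_elem_iff[OF S] by blast
  qed
next
  assume R: ?R
  have eq: "k = l"
    if "\<beta> \<in> apery (multiplicity S) E" "e \<in> ideal_min_gens S E" "f \<in> ideal_min_gens S E"
      and kl: "k \<in> lengths S (int \<beta> - int e)" "l \<in> lengths S (int \<beta> - int f)" for \<beta> e f k l
  proof -
    obtain x y where xy: "int \<beta> - int e = int x" "int \<beta> - int f = int y"
      using kl by (metis lengths_nonempty)
    then have "\<beta> = e + x" "\<beta> = f + y" by linarith+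
    moreover have "nfold_sum (min_gens S) k x" "nfold_sum (min_gens S) l y"
      using kl by (simp_all add: xy lengths_eq[OF S])
    ultimately show ?thesis using R that by blast
  qed
  show "homogeneous_ideal S E"
    unfolding homogeneous_ideal_def homogeneous_elem_iff[OF S]
    using eq by (intro ballI conjI impI equalityI subsetI) (blast, (metis all_not_in_conv)+)
qed

text \<open>Moving \<open>m\<close> to the other side replaces the integer subtraction by an
  addition of natural numbers.\<close>

lemma mem_apery_iff: "x \<in> apery m X \<longleftrightarrow> x \<in> X \<and> (\<forall>y\<in>X. x \<noteq> y + m)"
proof -
  have "int x - int m = int y \<longleftrightarrow> x = y + m" for y by linarith
  then show ?thesis by (auto simp: apery_def image_iff)
qed

lemma multiplicity_least:
  assumes "numerical_semigroup S"
  shows "multiplicity S \<in> S" "multiplicity S \<noteq> 0"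
    "\<And>x. x \<in> S \<Longrightarrow> x \<noteq> 0 \<Longrightarrow> multiplicity S \<le> x"
proof -
  have "\<exists>n. n \<in> S \<and> n \<noteq> 0"
    using numerical_semigroup_pos[OF assms] by (metis less_numeral_extra(3))
  then show "multiplicity S \<in> S" "multiplicity S \<noteq> 0"
    unfolding multiplicity_def by (metis (mono_tags, lifting) LeastI_ex)+
  show "multiplicity S \<le> x" if "x \<in> S" "x \<noteq> 0" for x
    unfolding multiplicity_def using that by (intro Least_le) simp
qed

section \<open>Ideals and their minimal generators\<close>

context
  fixes S E :: "nat set"
  assumes S: "numerical_semigroup S" and E: "sg_ideal S E"
begin

lemma ideal_add: "x \<in> E \<Longrightarrow> s \<in> S \<Longrightarrow> x + s \<in> E"
  using E by (auto simp: sg_ideal_def)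

lemma ideal_subset: "x \<in> E \<Longrightarrow> x \<in> S"
  using E by (auto simp: sg_ideal_def)

lemma is_ideal_min_gens_ideal_min_gens: "is_ideal_min_gens S E (ideal_min_gens S E)"
  unfolding ideal_min_gens_def by (rule theI') (rule ideal_min_gens_exists_unique[OF S E])

lemma ideal_min_gens_eq:
  "ideal_min_gens S E = {x \<in> E. \<forall>y\<in>E. \<forall>s\<in>S. x = y + s \<longrightarrow> s = 0}"
  using is_ideal_min_gens_iff[OF S E] is_ideal_min_gens_ideal_min_gens by simp

lemma ideal_min_gens_irreducible:
  assumes "x \<in> ideal_min_gens S E" "y \<in> E" "s \<in> S" "x = y + s"
  shows "s = 0"
  using assms unfolding ideal_min_gens_eq by simp

lemma ideal_min_gens_obtain:
  assumes "x \<in> E"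
  obtains e s where "e \<in> ideal_min_gens S E" "s \<in> S" "x = e + s"
proof -
  have "x \<in> (\<Union>e\<in>ideal_min_gens S E. e +o S)"
    using is_ideal_min_gens_ideal_min_gens assms unfolding is_ideal_min_gens_def by metis
  then show ?thesis using that by (auto simp: elt_set_plus_def)
qed

text \<open>The conclusion is membership in \<open>S\<close> rather than \<open>E\<close>, because
  the empty sum 0 need not lie in \<open>E\<close>.\<close>

lemma nfold_sum_ideal_min_gens:
  assumes "nfold_sum (ideal_min_gens S E) k x"
  shows "x \<in> S"
  using assms
  by induction (auto simp: ideal_min_gens_eq numerical_semigroup_0[OF S]
      intro: numerical_semigroup_add[OF S] ideal_subset)

text \<open>For any \<open>e\<close> in \<open>E\<close>, the ideal contains the translate
  \<open>e + S\<close> of a cofinite set.\<close>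

lemma finite_ideal_complement: "finite (UNIV - E)"
proof -
  obtain e where e: "e \<in> E" using E by (auto simp: sg_ideal_def)
  have "UNIV - E \<subseteq> {..<e} \<union> (\<lambda>x. e + x) ` (UNIV - S)"
  proof
    fix x assume x: "x \<in> UNIV - E"
    show "x \<in> {..<e} \<union> (\<lambda>x. e + x) ` (UNIV - S)"
    proof (cases "x < e")
      case False
      then have "x = e + (x - e)" by simp
      moreover from this have "x - e \<in> UNIV - S" using ideal_add[OF e] x by force
      ultimately show ?thesis by blast
    qed simp
  qed
  then show ?thesis
    by (rule finite_subset) (use S in \<open>simp add: numerical_semigroup_def\<close>)
qed

section \<open>Multiplicity, Apery set and minimal generators of the duplication\<close>

context
  fixes b :: nat
  assumes E0: "0 \<notin> E" and bS: "b \<in> S" and b: "odd b"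
begin

text \<open>As \<open>b\<close> is odd, the two halves of the duplication have opposite parities and
  cannot overlap.\<close>

lemma even_mem_duplication_iff: "2 * x \<in> duplication S b E \<longleftrightarrow> x \<in> S"
proof -
  have "2 * x \<noteq> 2 * e + b" for e using b by presburger
  then show ?thesis by (auto simp: duplication_def)
qed

lemma odd_mem_duplication_iff: "2 * x + b \<in> duplication S b E \<longleftrightarrow> x \<in> E"
proof -
  have "2 * x + b \<noteq> 2 * s" for s using b by presburger
  then show ?thesis by (auto simp: duplication_def)
qed

lemma duplication_cases:
  assumes "x \<in> duplication S b E"
  obtains s where "s \<in> S" "x = 2 * s" | e where "e \<in> E" "x = 2 * e + b"
  using assms by (auto simp: duplication_def)

text \<open>Reduces the computation of the Apery set and of the minimal generators to separate
  membership tests for \<open>2 * s\<close> and \<open>2 * e + b\<close>.\<close>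

lemma duplication_subset_eqI:
  assumes X: "X \<subseteq> duplication S b E"
    and "\<And>s. 2 * s \<in> X \<longleftrightarrow> s \<in> A" "\<And>e. 2 * e + b \<in> X \<longleftrightarrow> e \<in> B"
  shows "X = (*) 2 ` A \<union> (\<lambda>e. 2 * e + b) ` B"
proof (intro equalityI subsetI)
  fix x assume x: "x \<in> X"
  with X have "x \<in> duplication S b E" by blast
  then show "x \<in> (*) 2 ` A \<union> (\<lambda>e. 2 * e + b) ` B"
    using x assms(2,3) by (cases x rule: duplication_cases) auto
qed (use assms(2,3) in auto)

lemma numerical_semigroup_duplication: "numerical_semigroup (duplication S b E)"
proof -
  have "x + y \<in> duplication S b E"
    if x: "x \<in> duplication S b E" and y: "y \<in> duplication S b E" for x y
    using x
  proof (cases x rule: duplication_cases)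
    case (1 s)
    note s = this
    show ?thesis using y
    proof (cases y rule: duplication_cases)
      case (1 t)
      then show ?thesis
        using s even_mem_duplication_iff[of "s + t"] numerical_semigroup_add[OF S] by simp
    next
      case (2 e)
      then show ?thesis
        using s odd_mem_duplication_iff[of "e + s"] ideal_add by (simp add: algebra_simps)
    qed
  next
    case (2 e)
    note e = this
    show ?thesis using y
    proof (cases y rule: duplication_cases)
      case (1 s)
      then show ?thesis
        using e odd_mem_duplication_iff[of "e + s"] ideal_add by (simp add: algebra_simps)
    next
      case (2 f)
      \<comment> \<open>The sum of two odd elements is \<open>2 * (e + f + b)\<close>, and its half
        lies in \<open>S\<close> because \<open>b\<close> does.\<close>
      then show ?thesis
        using e even_mem_duplication_iff[of "e + f + b"] numerical_semigroup_add[OF S] bS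
          ideal_subset by (simp add: algebra_simps)
    qed
  qed
  moreover have "finite (UNIV - duplication S b E)"
  proof (rule finite_subset)
    show "UNIV - duplication S b E \<subseteq>
      (*) 2 ` (UNIV - S) \<union> (\<lambda>x. 2 * x + b) ` (UNIV - E) \<union> {..<b}"
    proof
      fix x assume x: "x \<in> UNIV - duplication S b E"
      \<comment> \<open>An odd number below \<open>b\<close> is not of the form
        \<open>2 * y + b\<close> with \<open>y\<close> natural, so the finitely many numbers below
        \<open>b\<close> are set apart.\<close>
      consider "x < b" | y where "x = 2 * y" | y where "x = 2 * y + b"
      proof (cases "even x \<or> x < b")
        case True
        then show ?thesis using that by blast
      next
        case False
        then have "x = 2 * ((x - b) div 2) + b" using b by (simp add: even_diff_nat)
        then show ?thesis using that by blast
      qed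
      then show "x \<in> (*) 2 ` (UNIV - S) \<union> (\<lambda>x. 2 * x + b) ` (UNIV - E) \<union> {..<b}"
        using x by cases (auto simp: even_mem_duplication_iff odd_mem_duplication_iff)
    qed
    show "finite ((*) 2 ` (UNIV - S) \<union> (\<lambda>x. 2 * x + b) ` (UNIV - E) \<union> {..<b})"
      using S finite_ideal_complement by (simp add: numerical_semigroup_def)
  qed
  ultimately show ?thesis
    using even_mem_duplication_iff[of 0] numerical_semigroup_0[OF S]
    by (simp add: numerical_semigroup_def)
qed

text \<open>No odd element is smaller: since 0 is not in \<open>E\<close>, each \<open>e\<close> in
  \<open>E\<close> is a nonzero element of \<open>S\<close>, whence \<open>2 * e + b\<close> exceeds
  twice the multiplicity.\<close>

lemma multiplicity_duplication: "multiplicity (duplication S b E) = 2 * multiplicity S"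
  unfolding multiplicity_def[of "duplication S b E"]
proof (rule Least_equality)
  show "2 * multiplicity S \<in> duplication S b E \<and> 2 * multiplicity S \<noteq> 0"
    using multiplicity_least[OF S] by (simp add: even_mem_duplication_iff)
  fix x assume "x \<in> duplication S b E \<and> x \<noteq> 0"
  then have "x \<in> duplication S b E" "x \<noteq> 0" by simp_all
  then show "2 * multiplicity S \<le> x"
  proof (cases x rule: duplication_cases)
    case (1 s)
    then show ?thesis using multiplicity_least(3)[OF S, of s] \<open>x \<noteq> 0\<close> by simp
  next
    case (2 e)
    then have "e \<in> S" "e \<noteq> 0" using E0 ideal_subset by metis+
    then have "multiplicity S \<le> e" by (rule multiplicity_least(3)[OF S])
    then show ?thesis using 2 by simp
  qed
qed

text \<open>Subtracting \<open>2 * m\<close> preserves parity, and on each half it amounts to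
  subtracting \<open>m\<close> from \<open>s\<close> or \<open>e\<close>.\<close>

lemma apery_duplication:
  "apery (2 * m) (duplication S b E) = (*) 2 ` apery m S \<union> (\<lambda>x. 2 * x + b) ` apery m E"
proof -
  have ne: "2 * s \<noteq> 2 * e + b + 2 * m" "2 * e + b \<noteq> 2 * s + 2 * m" for s e
    using b by presburger+
  have "2 * s \<in> apery (2 * m) (duplication S b E) \<longleftrightarrow> s \<in> apery m S" for s
    using ne by (auto simp: mem_apery_iff even_mem_duplication_iff)
      (auto simp: duplication_def)
  moreover have "2 * e + b \<in> apery (2 * m) (duplication S b E) \<longleftrightarrow> e \<in> apery m E" for e
    using ne by (auto simp: mem_apery_iff odd_mem_duplication_iff)
      (auto simp: duplication_def)
  moreover have "apery (2 * m) (duplication S b E) \<subseteq> duplication S b E"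
    by (auto simp: apery_def)
  ultimately show ?thesis by (intro duplication_subset_eqI)
qed

text \<open>Parity restricts the decompositions. An odd element splits only as odd plus even, which
  is a decomposition \<open>e = f + s\<close> in the ideal. An even one splits as even plus even,
  which is a decomposition in \<open>S\<close>, or as odd plus odd.\<close>

lemma min_gens_duplication:
  "min_gens (duplication S b E) = (*) 2 ` min_gens S \<union> (\<lambda>e. 2 * e + b) ` ideal_min_gens S E"
proof -
  let ?D = "duplication S b E"
  note D = numerical_semigroup_duplication
  have even: "2 * s \<in> min_gens ?D \<longleftrightarrow> s \<in> min_gens S" for s
  proof
    assume s: "2 * s \<in> min_gens ?D"
    have "y = 0 \<or> z = 0" if "y \<in> S" "z \<in> S" "s = y + z" for y z
    proof -
      have "2 * y \<in> ?D" "2 * z \<in> ?D" "2 * s = 2 * y + 2 * z"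
        using that by (simp_all add: even_mem_duplication_iff)
      then have "2 * y = 0 \<or> 2 * z = 0"
        by (rule min_gens_irreducible[OF D s])
      then show ?thesis by simp
    qed
    then show "s \<in> min_gens S"
      using s unfolding min_gens_eq[OF D] min_gens_eq[OF S]
      by (auto simp: even_mem_duplication_iff)
  next
    assume s: "s \<in> min_gens S"
    have "y = 0 \<or> z = 0" if y: "y \<in> ?D" and z: "z \<in> ?D" and yz: "2 * s = y + z" for y z
      using y
    proof (cases y rule: duplication_cases)
      case (1 t)
      note t = this
      show ?thesis using z
      proof (cases z rule: duplication_cases)
        case (1 u)
        then have "s = t + u" using t yz by simp
        then show ?thesis using min_gens_irreducible[OF S s] t 1 by auto
      next
        case (2 f)
        then show ?thesis using t yz b by presburger
      qed
    next
      case (2 e)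
      note e = this
      show ?thesis using z
      proof (cases z rule: duplication_cases)
        case (1 u)
        then show ?thesis using e yz b by presburger
      next
        case (2 f)
        \<comment> \<open>Halving a sum of two odd elements gives a decomposition in
          \<open>S\<close> with both parts nonzero, which a minimal generator does not
          admit.\<close>
        then have "s = e + (f + b)" using e yz by simp
        moreover have "e \<in> S" "f + b \<in> S"
          using e 2 bS ideal_subset numerical_semigroup_add[OF S] by auto
        moreover have "e \<noteq> 0" "f + b \<noteq> 0"
          using E0 e 2 b by (auto intro: gr0I)
        ultimately show ?thesis using min_gens_irreducible[OF S s] by blast
      qed
    qed
    then show "2 * s \<in> min_gens ?D"
      using s unfolding min_gens_eq[OF D] min_gens_eq[OF S]
      by (auto simp: even_mem_duplication_iff)
  qed
  have odd: "2 * e + b \<in> min_gens ?D \<longleftrightarrow> e \<in> ideal_min_gens S E" for e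
  proof
    assume e: "2 * e + b \<in> min_gens ?D"
    have "s = 0" if "f \<in> E" "s \<in> S" "e = f + s" for f s
    proof -
      have "2 * f + b \<in> ?D" "2 * s \<in> ?D" "2 * e + b = (2 * f + b) + 2 * s"
        using that by (simp_all add: even_mem_duplication_iff odd_mem_duplication_iff)
      then have "2 * f + b = 0 \<or> 2 * s = 0"
        by (rule min_gens_irreducible[OF D e])
      then show ?thesis using b by auto
    qed
    then show "e \<in> ideal_min_gens S E"
      using e unfolding min_gens_eq[OF D] ideal_min_gens_eq
      by (auto simp: odd_mem_duplication_iff)
  next
    assume e: "e \<in> ideal_min_gens S E"
    have "y = 0 \<or> z = 0" if y: "y \<in> ?D" and z: "z \<in> ?D" and yz: "2 * e + b = y + z" for y z
      using y
    proof (cases y rule: duplication_cases)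
      case (1 t)
      note t = this
      show ?thesis using z
      proof (cases z rule: duplication_cases)
        case (1 u)
        then show ?thesis using t yz b by presburger
      next
        case (2 f)
        then have "e = f + t" using t yz by simp
        then show ?thesis using ideal_min_gens_irreducible[OF e] t 2 by auto
      qed
    next
      case (2 f)
      note f = this
      show ?thesis using z
      proof (cases z rule: duplication_cases)
        case (1 u)
        then have "e = f + u" using f yz by simp
        then show ?thesis using ideal_min_gens_irreducible[OF e] f 1 by auto
      next
        case (2 g)
        then show ?thesis using f yz b by presburger
      qed
    qed
    moreover have "2 * e + b \<noteq> 0" using b by (cases b) auto
    ultimately show "2 * e + b \<in> min_gens ?D"
      using e unfolding min_gens_eq[OF D] ideal_min_gens_eq
      by (auto simp: odd_mem_duplication_iff)
  qed
  have "min_gens ?D \<subseteq> ?D" by (auto simp: min_gens_eq[OF D])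
  then show ?thesis
    using even odd by (intro duplication_subset_eqI)
qed

section \<open>Representations in the duplication\<close>

text \<open>Sorts the generators by parity: the \<open>p\<close> even ones contribute
  \<open>2 * x\<close>, the \<open>q\<close> odd ones \<open>2 * y + q * b\<close>.\<close>

lemma nfold_sum_duplicationD:
  assumes "nfold_sum (min_gens (duplication S b E)) k z"
  shows "\<exists>p q x y. nfold_sum (min_gens S) p x \<and> nfold_sum (ideal_min_gens S E) q y \<and>
    k = p + q \<and> z = 2 * x + 2 * y + q * b"
  using assms
proof induction
  case nfold_sum_0
  show ?case using nfold_sum.nfold_sum_0 by fastforce
next
  case (nfold_sum_Suc g k z)
  then obtain p q x y where *: "nfold_sum (min_gens S) p x" "nfold_sum (ideal_min_gens S E) q y"
    "k = p + q" "z = 2 * x + 2 * y + q * b" by blast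
  consider h where "h \<in> min_gens S" "g = 2 * h" | e where "e \<in> ideal_min_gens S E" "g = 2 * e + b"
    using nfold_sum_Suc.hyps(1) by (auto simp: min_gens_duplication)
  then show ?case
  proof cases
    case 1
    then have "nfold_sum (min_gens S) (Suc p) (h + x)"
      using *(1) by (intro nfold_sum.nfold_sum_Suc)
    moreover have "Suc k = Suc p + q" "g + z = 2 * (h + x) + 2 * y + q * b"
      using *(3,4) 1 by simp_all
    ultimately show ?thesis using *(2) by blast
  next
    case 2
    then have "nfold_sum (ideal_min_gens S E) (Suc q) (e + y)"
      using *(2) by (intro nfold_sum.nfold_sum_Suc)
    moreover have "Suc k = p + Suc q" "g + z = 2 * x + 2 * (e + y) + Suc q * b"
      using *(3,4) 2 by simp_all
    ultimately show ?thesis using *(1) by blast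
  qed
qed

lemma nfold_sum_duplication_even:
  assumes "nfold_sum (min_gens S) k x"
  shows "nfold_sum (min_gens (duplication S b E)) k (2 * x)"
  using assms
  by induction (auto simp: min_gens_duplication intro: nfold_sum_Suc)

lemma nfold_sum_duplication_odd:
  assumes "e \<in> ideal_min_gens S E" "nfold_sum (min_gens (duplication S b E)) k x"
  shows "nfold_sum (min_gens (duplication S b E)) (Suc k) (2 * e + b + x)"
  using assms by (intro nfold_sum_Suc) (auto simp: min_gens_duplication)

text \<open>One generator of the ideal is kept as the first summand; a second one absorbs all that
  remains, which lies in \<open>S\<close>.\<close>

lemma two_generators_mem_sumset:
  assumes "x \<in> S" "nfold_sum (ideal_min_gens S E) (Suc (Suc q)) y"
  shows "x + y + k * b \<in> E + E"
proof -
  obtain e f z where *: "e \<in> ideal_min_gens S E" "f \<in> ideal_min_gens S E" "y = e + (f + z)"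
    "nfold_sum (ideal_min_gens S E) q z"
    using assms(2) by (auto simp: nfold_sum_Suc_iff)
  then have "e \<in> E" "f \<in> E" "z \<in> S"
    using nfold_sum_ideal_min_gens by (auto simp: ideal_min_gens_eq)
  then have "f + (x + (z + k * b)) \<in> E"
    using assms(1) numerical_semigroup_mult[OF S bS]
    by (intro ideal_add numerical_semigroup_add[OF S])
  moreover have "x + y + k * b = e + (f + (x + (z + k * b)))" using *(3) by simp
  ultimately show ?thesis using \<open>e \<in> E\<close> by (metis set_plus_intro)
qed

text \<open>The form \<open>Suc k\<close> records that the length is positive, which makes the later
  comparison of lengths strict.\<close>

lemma nfold_sum_positive:
  assumes "x \<in> S" "x \<noteq> 0"
  obtains k where "nfold_sum (min_gens S) (Suc k) x"
proof -
  obtain k where k: "nfold_sum (min_gens S) k x"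
    using assms(1) mem_numerical_semigroup_iff[OF S] by blast
  with assms(2) that show ?thesis by (cases k) auto
qed

section \<open>The two implications\<close>

text \<open>Representations in \<open>S\<close> of \<delta> and of \<beta> - e lift to the
  duplication, with length unchanged and increased by one respectively, so uniqueness of lengths is
  inherited.\<close>

lemma homogeneous_duplicationD:
  assumes hom: "homogeneous_sg (duplication S b E)"
  shows "homogeneous_sg S" "homogeneous_ideal S E"
    "\<And>\<delta>. \<delta> \<in> apery (multiplicity S) S \<Longrightarrow> \<delta> \<notin> (\<lambda>x. x + b) ` (E + E)"
proof -
  let ?D = "duplication S b E"
  have uniq: "k = l"
    if "x \<in> apery (multiplicity S) S \<and> z = 2 * x \<or> x \<in> apery (multiplicity S) E \<and> z = 2 * x + b"
      "nfold_sum (min_gens ?D) k z" "nfold_sum (min_gens ?D) l z" for x z k l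
    using hom that unfolding homogeneous_sg_iff[OF numerical_semigroup_duplication]
      multiplicity_duplication apery_duplication by blast
  show "homogeneous_sg S"
    unfolding homogeneous_sg_iff[OF S]
    using uniq nfold_sum_duplication_even by blast
  show "homogeneous_ideal S E"
    unfolding homogeneous_ideal_iff[OF S]
  proof (intro ballI allI impI)
    fix \<beta> e f x y k l
    assume *: "\<beta> \<in> apery (multiplicity S) E" "e \<in> ideal_min_gens S E" "f \<in> ideal_min_gens S E"
      "\<beta> = e + x" "\<beta> = f + y" "nfold_sum (min_gens S) k x" "nfold_sum (min_gens S) l y"
    have eq: "2 * e + b + 2 * x = 2 * \<beta> + b" "2 * f + b + 2 * y = 2 * \<beta> + b"
      using *(4,5) by simp_all
    have "nfold_sum (min_gens ?D) (Suc k) (2 * \<beta> + b)"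
      "nfold_sum (min_gens ?D) (Suc l) (2 * \<beta> + b)"
      using nfold_sum_duplication_odd[OF *(2) nfold_sum_duplication_even[OF *(6)]]
        nfold_sum_duplication_odd[OF *(3) nfold_sum_duplication_even[OF *(7)]]
      by (simp_all only: eq)
    then show "k = l" using uniq *(1) by blast
  qed
  fix \<delta> assume \<delta>: "\<delta> \<in> apery (multiplicity S) S"
  show "\<delta> \<notin> (\<lambda>x. x + b) ` (E + E)"
  proof
    assume "\<delta> \<in> (\<lambda>x. x + b) ` (E + E)"
    then obtain x y where xy: "x \<in> E" "y \<in> E" "\<delta> = x + y + b"
      by (auto elim!: set_plus_elim)
    obtain e s where e: "e \<in> ideal_min_gens S E" "s \<in> S" "x = e + s"
      using ideal_min_gens_obtain xy(1) .
    obtain f t where f: "f \<in> ideal_min_gens S E" "t \<in> S" "y = f + t"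
      using ideal_min_gens_obtain xy(2) .
    have "e \<in> E" "f \<in> E" using e(1) f(1) by (auto simp: ideal_min_gens_eq)
    then have "e \<in> S" "e \<noteq> 0" "f \<in> S" "f \<noteq> 0" using E0 ideal_subset by metis+
    then obtain k l where k: "nfold_sum (min_gens S) (Suc k) e"
      and l: "nfold_sum (min_gens S) (Suc l) f"
      using nfold_sum_positive by metis
    have "b \<noteq> 0" using odd_pos[OF b] by simp
    then obtain n where n: "nfold_sum (min_gens S) (Suc n) b"
      using nfold_sum_positive bS by metis
    have "s + t \<in> S" using e(2) f(2) numerical_semigroup_add[OF S] by blast
    then obtain p where p: "nfold_sum (min_gens S) p (s + t)"
      using mem_numerical_semigroup_iff[OF S] by blast
    \<comment> \<open>First representation: \<open>e\<close>, \<open>f\<close> and \<open>b\<close>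
      are all expanded in \<open>S\<close>, and doubling yields even generators only.\<close>
    have "nfold_sum (min_gens S) (Suc k + (Suc l + (Suc n + p))) (e + (f + (b + (s + t))))"
      by (intro nfold_sum_add k l n p)
    from nfold_sum_duplication_even[OF this]
    have 1: "nfold_sum (min_gens ?D) (Suc k + (Suc l + (Suc n + p))) (2 * \<delta>)"
      using xy(3) e(3) f(3) by (simp add: algebra_simps)
    \<comment> \<open>Second representation: \<open>2 * e + b\<close> and \<open>2 * f + b\<close>
      are kept as two generators. It is shorter by \<open>k + l + n + 1\<close>.\<close>
    have 2: "nfold_sum (min_gens ?D) (Suc (Suc p)) (2 * \<delta>)"
      using nfold_sum_duplication_odd[OF e(1)
          nfold_sum_duplication_odd[OF f(1) nfold_sum_duplication_even[OF p]]]
        xy(3) e(3) f(3) by (simp add: algebra_simps)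
    have "Suc k + (Suc l + (Suc n + p)) = Suc (Suc p)"
      using uniq[OF _ 1 2] \<delta> by blast
    then show False by simp
  qed
qed

text \<open>Parity fixes whether the number of odd generators is even or odd, and disjointness from
  \<open>2E + b\<close> leaves only none or one. What remains are representations in
  \<open>S\<close> of \<delta> or of \<beta> - e.\<close>

lemma homogeneous_duplicationI:
  assumes homS: "homogeneous_sg S" and homE: "homogeneous_ideal S E"
    and disj: "\<And>\<delta>. \<delta> \<in> apery (multiplicity S) S \<Longrightarrow> \<delta> \<notin> (\<lambda>x. x + b) ` (E + E)"
  shows "homogeneous_sg (duplication S b E)"
proof -
  let ?D = "duplication S b E" and ?m = "multiplicity S"
  have even: "nfold_sum (min_gens S) k \<delta>"
    if \<delta>: "\<delta> \<in> apery ?m S" and k: "nfold_sum (min_gens ?D) k (2 * \<delta>)" for \<delta> k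
  proof -
    obtain p q x y where *: "nfold_sum (min_gens S) p x" "nfold_sum (ideal_min_gens S E) q y"
      "k = p + q" "2 * \<delta> = 2 * x + 2 * y + q * b"
      using nfold_sum_duplicationD[OF k] by blast
    have "even (q * b)" using *(4) by presburger
    then obtain r where r: "q = 2 * r" using b by auto
    show ?thesis
    proof (cases r)
      case 0
      then show ?thesis using * r by simp
    next
      case (Suc r')
      have "x \<in> S" using *(1) mem_numerical_semigroup_iff[OF S] by blast
      \<comment> \<open>Of the \<open>r\<close> copies of \<open>b\<close> in \<delta>, one is
        reserved for the shift in \<open>2E + b\<close>; the other \<open>r'\<close> are absorbed
        into the sumset.\<close>
      then have "x + y + r' * b \<in> E + E"
        using two_generators_mem_sumset[of x "2 * r'"] *(2) r Suc by simp
      moreover have "\<delta> = x + y + r' * b + b" using *(4) r Suc by (simp add: algebra_simps)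
      ultimately show ?thesis using disj[OF \<delta>] by blast
    qed
  qed
  have odd: "\<exists>e\<in>ideal_min_gens S E. \<exists>x p. \<beta> = e + x \<and> nfold_sum (min_gens S) p x \<and> k = Suc p"
    if \<beta>: "\<beta> \<in> apery ?m E" and k: "nfold_sum (min_gens ?D) k (2 * \<beta> + b)" for \<beta> k
  proof -
    obtain p q x y where *: "nfold_sum (min_gens S) p x" "nfold_sum (ideal_min_gens S E) q y"
      "k = p + q" "2 * \<beta> + b = 2 * x + 2 * y + q * b"
      using nfold_sum_duplicationD[OF k] by blast
    have "odd (q * b)" using *(4) b by presburger
    then obtain r where r: "q = Suc (2 * r)" by (auto elim!: oddE)
    then obtain e z where e: "e \<in> ideal_min_gens S E" "y = e + z"
      "nfold_sum (ideal_min_gens S E) (2 * r) z"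
      using *(2) by (auto simp: nfold_sum_Suc_iff)
    have \<beta>eq: "\<beta> = e + (x + z + r * b)" using *(4) r e(2) by (simp add: algebra_simps)
    show ?thesis
    proof (cases r)
      case 0
      then have "\<beta> = e + x" "k = Suc p" using \<beta>eq e(3) *(3) r by simp_all
      with e(1) *(1) show ?thesis by blast
    next
      case (Suc r')
      let ?\<delta> = "x + z + r * b"
      have xS: "x \<in> S" using *(1) mem_numerical_semigroup_iff[OF S] by blast
      have "z \<in> S" using nfold_sum_ideal_min_gens e(3) .
      then have "?\<delta> \<in> S"
        using xS numerical_semigroup_mult[OF S bS] by (intro numerical_semigroup_add[OF S])
      \<comment> \<open>Subtracting the multiplicity from \<beta> - e within \<open>S\<close> would
        do the same to \<beta> within \<open>E\<close>.\<close>
      moreover have "?\<delta> \<noteq> s + ?m" if "s \<in> S" for s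
      proof
        assume "?\<delta> = s + ?m"
        then have "\<beta> = (e + s) + ?m" using \<beta>eq by simp
        moreover have "e + s \<in> E" using e(1) that ideal_add by (auto simp: ideal_min_gens_eq)
        ultimately show False using \<beta> by (auto simp: mem_apery_iff)
      qed
      ultimately have "?\<delta> \<in> apery ?m S" by (auto simp: mem_apery_iff)
      \<comment> \<open>With \<open>e\<close> split off, \<open>2 * r\<close> odd generators remain,
        hence at least two.\<close>
      moreover have "x + z + r' * b \<in> E + E"
        using two_generators_mem_sumset[OF xS, of "2 * r'"] e(3) Suc by simp
      moreover have "?\<delta> = x + z + r' * b + b" using Suc by simp
      ultimately show ?thesis using disj by blast
    qed
  qed
  show ?thesis
    unfolding homogeneous_sg_iff[OF numerical_semigroup_duplication] multiplicity_duplication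
      apery_duplication
  proof (intro ballI allI impI)
    fix z k l
    assume "z \<in> (*) 2 ` apery ?m S \<union> (\<lambda>x. 2 * x + b) ` apery ?m E"
      and k: "nfold_sum (min_gens ?D) k z" and l: "nfold_sum (min_gens ?D) l z"
    then consider \<delta> where "\<delta> \<in> apery ?m S" "z = 2 * \<delta>"
      | \<beta> where "\<beta> \<in> apery ?m E" "z = 2 * \<beta> + b" by blast
    then show "k = l"
    proof cases
      case 1
      then show ?thesis
        using homS even k l unfolding homogeneous_sg_iff[OF S] by blast
    next
      case 2
      \<comment> \<open>The two representations may use different odd generators, which is why
        lengths of \<beta> - e and \<beta> - f have to be compared.\<close>
      then obtain e x p f y q
        where "e \<in> ideal_min_gens S E" "\<beta> = e + x" "nfold_sum (min_gens S) p x" "k = Suc p"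
          "f \<in> ideal_min_gens S E" "\<beta> = f + y" "nfold_sum (min_gens S) q y" "l = Suc q"
        using odd k l by metis
      with homE 2(1) show ?thesis unfolding homogeneous_ideal_iff[OF S] by blast
    qed
  qed
qed

end

end

theorem theorem4p4:
  fixes S E :: "nat set" and b :: nat
  assumes "numerical_semigroup S"
    and "sg_ideal S E"
    and "0 \<notin> E"
    and "b \<in> S"
    and "odd b"
  shows "homogeneous_sg (duplication S b E) \<longleftrightarrow>
    homogeneous_sg S \<and> homogeneous_ideal S E \<and>
    (\<forall>\<delta>\<in>apery (multiplicity S) S. \<delta> \<notin> (\<lambda>x. x + b) ` (E + E))"
  using homogeneous_duplicationD[OF assms] homogeneous_duplicationI[OF assms] by blast

end
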